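(* Let $\mathfrak{M}:=\{n \in \mathbb{N} : \mathbf{G}_n(n) \equiv 0 \pmod n\}$ and, for a prime $p$, let $\mathfrak{U}_p:=\{n \in\mathbb{N} : p^3-p \mid n,\ p^2 \nmid n\}$. Then: (i) $\displaystyle \mathbb{N}\setminus\mathfrak{M}=\bigcup_{\substack{p\ \text{prime}\\ p\equiv 3\pmod{4}}}\mathfrak{U}_p$. (ii) $\mathfrak{M}$ has an asymptotic density.
   Context: $\mathbb{N}$ denotes the positive integers. For integers $k,n\ge 1$, $\mathbf{G}_k(n):=\sum_{1\leq a,b\leq n}(a+bi)^k\in\mathbb{Z}[i]$, and congruence modulo $n$ is modulo the ideal $n\mathbb{Z}[i]$. A set $A\subseteq\mathbb{N}$ has an asymptotic density if $\delta(A)=\lim_{N\to\infty}\frac{1}{N}\#(A\cap[1,N])$ exists. *)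

theory Defs
  imports Complex_Main "HOL-Number_Theory.Cong"
begin

definition gaussian_ints :: "complex set" where
  "gaussian_ints = {of_int a + of_int b * \<i> | a b. True}"

definition gauss_cong :: "complex \<Rightarrow> complex \<Rightarrow> nat \<Rightarrow> bool" where
  "gauss_cong x y n \<longleftrightarrow> x - y \<in> (\<lambda>z. of_nat n * z) ` gaussian_ints"

definition gauss_power_sum :: "nat \<Rightarrow> nat \<Rightarrow> complex" where
  "gauss_power_sum k n = (\<Sum>a=1..n. \<Sum>b=1..n. (of_nat a + of_nat b * \<i>) ^ k)"

definition M_set :: "nat set" where
  "M_set = {n. n \<ge> 1 \<and> gauss_cong (gauss_power_sum n n) 0 n}"

text \<open>The subtraction on \<open>nat\<close> does not truncate, as \<open>p \<le> p ^ 3\<close>.\<close>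

definition U_set :: "nat \<Rightarrow> nat set" where
  "U_set p = {n. n \<ge> 1 \<and> p ^ 3 - p dvd n \<and> \<not> p ^ 2 dvd n}"

definition has_asymptotic_density :: "nat set \<Rightarrow> bool" where
  "has_asymptotic_density A \<longleftrightarrow>
     convergent (\<lambda>N. real (card (A \<inter> {1..N})) / real N)"

lemma gaussian_ints_0: "0 \<in> gaussian_ints"
  unfolding gaussian_ints_def by (auto intro!: exI[of _ "0::int"])

lemma gaussian_ints_add:
  assumes "x \<in> gaussian_ints" and "y \<in> gaussian_ints"
  shows "x + y \<in> gaussian_ints"
proof -
  from assms obtain a b c d where
    "x = of_int a + of_int b * \<i>" "y = of_int c + of_int d * \<i>"
    unfolding gaussian_ints_def by blast
  then have "x + y = of_int (a + c) + of_int (b + d) * \<i>"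
    by (simp add: algebra_simps)
  then show ?thesis unfolding gaussian_ints_def by blast
qed

lemma gaussian_ints_mult:
  assumes "x \<in> gaussian_ints" and "y \<in> gaussian_ints"
  shows "x * y \<in> gaussian_ints"
proof -
  from assms obtain a b c d where
    "x = of_int a + of_int b * \<i>" "y = of_int c + of_int d * \<i>"
    unfolding gaussian_ints_def by blast
  then have "x * y = of_int (a * c - b * d) + of_int (a * d + b * c) * \<i>"
    by (simp add: complex_eq_iff)
  then show ?thesis unfolding gaussian_ints_def by blast
qed

lemma gaussian_ints_of_nat: "of_nat a + of_nat b * \<i> \<in> gaussian_ints"
proof -
  have "of_nat a + of_nat b * \<i> = (of_int (int a) + of_int (int b) * \<i> :: complex)"
    by simp
  then show ?thesis unfolding gaussian_ints_def by blast
qed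

lemma gaussian_ints_power: "x \<in> gaussian_ints \<Longrightarrow> x ^ k \<in> gaussian_ints"
  by (induction k)
    (use gaussian_ints_of_nat[of 1 0] in \<open>auto intro: gaussian_ints_mult\<close>)

lemma gaussian_ints_sum:
  "(\<And>i. i \<in> A \<Longrightarrow> f i \<in> gaussian_ints) \<Longrightarrow> sum f A \<in> gaussian_ints"
  by (induction A rule: infinite_finite_induct) (auto intro: gaussian_ints_0 gaussian_ints_add)

lemma gauss_power_sum_in_gaussian_ints: "gauss_power_sum k n \<in> gaussian_ints"
  unfolding gauss_power_sum_def
  by (intro gaussian_ints_sum) (auto intro: gaussian_ints_power gaussian_ints_of_nat)

end

theory Submission
  imports Defs "HOL-Number_Theory.Residues"
begin

text \<open>
  The power sum \<open>G\<^sub>n(n)\<close> is examined one prime power \<open>p ^ s\<close> dividing \<open>n\<close> at a time. If \<open>s \<ge> 2\<close> it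
  vanishes modulo \<open>p ^ s\<close>: grouping the points of the square by their residues and expanding to
  first order gives \<open>G\<^sub>k(m p) \<equiv> p\<^sup>2 G\<^sub>k(m)\<close> modulo \<open>m p\<close> whenever \<open>p\<close> divides \<open>m\<close>
  (\<open>gauss_power_sum_descent\<close>). If \<open>p\<close> divides \<open>n\<close> exactly once, then \<open>G\<^sub>n(n)\<close> is congruent to
  \<open>(n / p)\<^sup>2 G\<^sub>n(p)\<close> modulo \<open>p\<close>, and everything depends on the sum of \<open>x ^ n\<close> over the ring
  \<open>\<int>[\<i>] / p\<close>.

  That sum is evaluated without field theory. Frobenius maps \<open>a + b \<i>\<close> to \<open>a + b \<i> ^ p\<close>, which
  reduces the exponent: to at most \<open>p - 1\<close> if \<open>p \<equiv> 1 (mod 4)\<close>, and to at most \<open>p\<^sup>2 - 1\<close> if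
  \<open>p \<equiv> 3 (mod 4)\<close>, where moreover \<open>p\<close>-th powers may be replaced by conjugates. The summand becomes
  a polynomial in \<open>a\<close> and \<open>b\<close> of degree at most \<open>2 (p - 1)\<close>, and a double sum over a full residue
  system kills all monomials of smaller degree (\<open>double_power_sum_cong_0\<close>). Degree \<open>2 (p - 1)\<close>
  is attained only if \<open>p \<equiv> 3 (mod 4)\<close> and \<open>p\<^sup>2 - 1\<close> divides \<open>n\<close>, and then the sum is not
  zero (\<open>gauss_power_sum_inert_not_cong_0\<close>). For \<open>p = 2\<close> the exponent \<open>n\<close> is even and the
  sum vanishes. Since \<open>p\<close> and \<open>p\<^sup>2 - 1\<close> are coprime, this describes exactly the sets
  \<open>U_set p\<close>.

  For the density, each \<open>U_set p\<close> is periodic on the positive integers and consists of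
  multiples of \<open>p ^ 3 - p\<close>. The series of the reciprocals converges, so the union is approximated in density by finite unions, which are
  again periodic.
\<close>

section \<open>Congruences of Gaussian integers\<close>

lemma gaussian_ints_uminus:
  assumes "x \<in> gaussian_ints"
  shows "- x \<in> gaussian_ints"
proof -
  from assms obtain a b where "x = of_int a + of_int b * \<i>"
    unfolding gaussian_ints_def by blast
  then have "- x = of_int (- a) + of_int (- b) * \<i>" by simp
  then show ?thesis unfolding gaussian_ints_def by blast
qed

lemma gaussian_ints_diff: "x \<in> gaussian_ints \<Longrightarrow> y \<in> gaussian_ints \<Longrightarrow> x - y \<in> gaussian_ints"
  using gaussian_ints_add[of x "-y"] gaussian_ints_uminus[of y] by simp

lemma nat_in_gaussian_ints [simp]: "of_nat a \<in> gaussian_ints"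
  using gaussian_ints_of_nat[of a 0] by simp

lemma imaginary_unit_in_gaussian_ints [simp]: "\<i> \<in> gaussian_ints"
  using gaussian_ints_of_nat[of 0 1] by simp

lemmas gaussian_ints_intros =
  gaussian_ints_0 gaussian_ints_add gaussian_ints_diff gaussian_ints_uminus gaussian_ints_mult
  gaussian_ints_power gaussian_ints_sum nat_in_gaussian_ints imaginary_unit_in_gaussian_ints

lemma gauss_congI: "z \<in> gaussian_ints \<Longrightarrow> x - y = of_nat n * z \<Longrightarrow> gauss_cong x y n"
  unfolding gauss_cong_def by blast

lemma gauss_congE:
  assumes "gauss_cong x y n"
  obtains z where "z \<in> gaussian_ints" "x = y + of_nat n * z"
  using assms unfolding gauss_cong_def by (auto simp: algebra_simps)

lemma gauss_cong_refl [simp]: "gauss_cong x x n"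
  by (rule gauss_congI[of 0]) (auto intro: gaussian_ints_intros)

lemma gauss_cong_sym: "gauss_cong x y n \<Longrightarrow> gauss_cong y x n"
  by (elim gauss_congE, rule gauss_congI[OF gaussian_ints_uminus]) auto

lemma gauss_cong_add:
  assumes "gauss_cong x y n" "gauss_cong x' y' n"
  shows "gauss_cong (x + x') (y + y') n"
proof -
  from assms obtain z z' where "z \<in> gaussian_ints" "x = y + of_nat n * z"
    "z' \<in> gaussian_ints" "x' = y' + of_nat n * z'" by (elim gauss_congE)
  then show ?thesis
    by (intro gauss_congI[of "z + z'"]) (auto intro: gaussian_ints_intros simp: algebra_simps)
qed

lemma gauss_cong_trans [trans]:
  assumes "gauss_cong x y n" "gauss_cong y w n"
  shows "gauss_cong x w n"
proof -
  from assms obtain z z' where "z \<in> gaussian_ints" "x = y + of_nat n * z"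
    "z' \<in> gaussian_ints" "y = w + of_nat n * z'" by (elim gauss_congE)
  then show ?thesis
    by (intro gauss_congI[of "z + z'"]) (auto intro: gaussian_ints_intros simp: algebra_simps)
qed

lemma gauss_cong_mult:
  assumes "gauss_cong x y n" "gauss_cong x' y' n" "x \<in> gaussian_ints" "y' \<in> gaussian_ints"
  shows "gauss_cong (x * x') (y * y') n"
proof -
  from assms obtain z z' where z: "z \<in> gaussian_ints" "x = y + of_nat n * z"
    "z' \<in> gaussian_ints" "x' = y' + of_nat n * z'" by (elim gauss_congE)
  have "x * x' - y * y' = of_nat n * (x * z' + z * y')"
    using z by (simp add: algebra_simps)
  then show ?thesis
    using assms z by (intro gauss_congI[of "x * z' + z * y'"]) (auto intro: gaussian_ints_intros)
qed

lemma gauss_cong_power: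
  assumes "gauss_cong x y n" "x \<in> gaussian_ints" "y \<in> gaussian_ints"
  shows "gauss_cong (x ^ k) (y ^ k) n"
  by (induction k) (use assms in \<open>auto intro!: gauss_cong_mult gaussian_ints_power\<close>)

lemma gauss_cong_sum:
  "(\<And>i. i \<in> I \<Longrightarrow> gauss_cong (f i) (g i) n) \<Longrightarrow> gauss_cong (sum f I) (sum g I) n"
  by (induction I rule: infinite_finite_induct) (auto intro: gauss_cong_add)

lemma gauss_cong_0_mult:
  "gauss_cong x 0 n \<Longrightarrow> y \<in> gaussian_ints \<Longrightarrow> gauss_cong (y * x) 0 n"
  using gauss_cong_mult[of y y n x 0] gaussian_ints_0 by simp

text \<open>Divisibility by \<open>n\<close> in \<open>\<int>[\<i>]\<close> can be read off the two coordinates, so arithmetic facts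
about integers, such as cancellation of a factor coprime to a prime modulus and the reduction to
prime powers, carry over coordinatewise.\<close>

lemma gauss_cong_0_iff:
  "gauss_cong (of_int a + of_int b * \<i>) 0 n \<longleftrightarrow> int n dvd a \<and> int n dvd b"
proof
  assume "gauss_cong (of_int a + of_int b * \<i>) 0 n"
  then obtain c d :: int where
    eq: "of_int a + of_int b * \<i> = of_nat n * (of_int c + of_int d * \<i>)"
    unfolding gauss_cong_def gaussian_ints_def by auto
  from arg_cong[OF eq, of Re] arg_cong[OF eq, of Im]
  have "real_of_int a = of_int (int n * c)" "real_of_int b = of_int (int n * d)" by simp_all
  then have "a = int n * c" "b = int n * d" by (simp_all only: of_int_eq_iff)
  then show "int n dvd a \<and> int n dvd b" by simp
next
  assume "int n dvd a \<and> int n dvd b"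
  then obtain c d where "a = int n * c" "b = int n * d" by (auto elim!: dvdE)
  then show "gauss_cong (of_int a + of_int b * \<i>) 0 n"
    by (intro gauss_congI[of "of_int c + of_int d * \<i>"])
      (auto simp: gaussian_ints_def algebra_simps)
qed

lemma gauss_cong_of_nat_0_iff: "gauss_cong (of_nat a) 0 n \<longleftrightarrow> n dvd a"
  using gauss_cong_0_iff[of "int a" 0 n] by simp

lemma gauss_cong_dvd_modulus:
  assumes "gauss_cong x y n" "d dvd n"
  shows "gauss_cong x y d"
proof -
  from assms obtain z e where "z \<in> gaussian_ints" "x = y + of_nat n * z" "n = d * e"
    by (elim gauss_congE dvdE)
  then show ?thesis
    by (intro gauss_congI[of "of_nat e * z"]) (auto intro: gaussian_ints_intros)
qed

lemma gauss_cong_0_mult_modulus: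
  assumes "gauss_cong x 0 n"
  shows "gauss_cong (of_nat m * x) 0 (m * n)"
  using assms by (elim gauss_congE) (auto intro!: gauss_congI)

lemma gauss_cong_0_prime_cancel:
  assumes "z \<in> gaussian_ints" "gauss_cong (of_nat c * z) 0 p" "prime p" "\<not> p dvd c"
  shows "gauss_cong z 0 p"
proof -
  obtain a b where z: "z = of_int a + of_int b * \<i>"
    using assms(1) unfolding gaussian_ints_def by blast
  have "gauss_cong (of_int (int c * a) + of_int (int c * b) * \<i>) 0 p"
    using assms(2) unfolding z by (simp add: algebra_simps)
  then have "int p dvd int c * a" "int p dvd int c * b" unfolding gauss_cong_0_iff by auto
  moreover have "prime (int p)" "\<not> int p dvd int c" using assms by auto
  ultimately show ?thesis unfolding z gauss_cong_0_iff by (simp add: prime_dvd_mult_iff)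
qed

lemma dvd_if_prime_powers_dvd:
  fixes a :: int
  assumes "n \<ge> 1" "\<And>p s. prime p \<Longrightarrow> s \<ge> 1 \<Longrightarrow> p ^ s dvd n \<Longrightarrow> int (p ^ s) dvd a"
  shows "int n dvd a"
proof (cases "a = 0")
  case False
  have "n dvd nat \<bar>a\<bar>"
  proof (rule multiplicity_le_imp_dvd)
    fix p :: nat assume p: "prime p"
    let ?s = "multiplicity p n"
    have "int (p ^ ?s) dvd a"
      using assms(2)[OF p, of ?s] by (cases "?s = 0") (auto simp: multiplicity_dvd)
    then have "p ^ ?s dvd nat \<bar>a\<bar>"
      by (simp only: int_dvd_int_iff[symmetric] int_nat_eq abs_ge_zero if_True dvd_abs_iff)
    then show "?s \<le> multiplicity p (nat \<bar>a\<bar>)"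
      using False p by (intro multiplicity_geI) auto
  qed (use assms in auto)
  then show ?thesis by (simp only: int_dvd_int_iff[symmetric] int_nat_eq abs_ge_zero if_True dvd_abs_iff)
qed auto

lemma gauss_cong_0_if_prime_powers:
  assumes "z \<in> gaussian_ints" "n \<ge> 1"
    "\<And>p s. prime p \<Longrightarrow> s \<ge> 1 \<Longrightarrow> p ^ s dvd n \<Longrightarrow> gauss_cong z 0 (p ^ s)"
  shows "gauss_cong z 0 n"
proof -
  obtain a b where z: "z = of_int a + of_int b * \<i>"
    using assms(1) unfolding gaussian_ints_def by blast
  have "int (p ^ s) dvd a \<and> int (p ^ s) dvd b" if "prime p" "s \<ge> 1" "p ^ s dvd n" for p s
    using assms(3)[OF that] unfolding z gauss_cong_0_iff .
  then show ?thesis unfolding z gauss_cong_0_iff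
    using dvd_if_prime_powers_dvd[OF assms(2)] by (metis (no_types, lifting))
qed

section \<open>Reduction to a prime modulus\<close>

lemma sum_block_split:
  fixes f :: "nat \<Rightarrow> 'a::comm_monoid_add"
  shows "(\<Sum>a=1..m*q. f a) = (\<Sum>y=1..m. \<Sum>z<q. f (y + m * z))"
proof (induction q)
  case (Suc q)
  have "(\<Sum>a=1..m * Suc q. f a) = (\<Sum>a=1..m*q. f a) + (\<Sum>a=m*q+1..m*q+m. f a)"
    by (subst sum.ub_add_nat[symmetric]) (auto simp: add.commute)
  also have "(\<Sum>a=m*q+1..m*q+m. f a) = (\<Sum>y=1..m. f (y + m * q))"
    using sum.shift_bounds_cl_nat_ivl[of f 1 "m*q" m] by (simp add: add.commute)
  finally show ?case unfolding Suc.IH by (simp add: sum.distrib)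
qed auto

text \<open>Cut the square of side \<open>m * q\<close> into \<open>q\<^sup>2\<close> translates of the square of side \<open>m\<close>: the
outer sums run over the position inside a translate, the inner ones over the translates.\<close>

lemma gauss_power_sum_split:
  "gauss_power_sum k (m * q) = (\<Sum>y1=1..m. \<Sum>y2=1..m. \<Sum>z1<q. \<Sum>z2<q.
     ((of_nat y1 + of_nat y2 * \<i>) + of_nat m * (of_nat z1 + of_nat z2 * \<i>)) ^ k)"
proof -
  have "gauss_power_sum k (m * q) = (\<Sum>y1=1..m. \<Sum>z1<q. \<Sum>y2=1..m. \<Sum>z2<q.
     (of_nat (y1 + m * z1) + of_nat (y2 + m * z2) * \<i>) ^ k)"
    unfolding gauss_power_sum_def sum_block_split ..
  also have "\<dots> = (\<Sum>y1=1..m. \<Sum>y2=1..m. \<Sum>z1<q. \<Sum>z2<q.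
     (of_nat (y1 + m * z1) + of_nat (y2 + m * z2) * \<i>) ^ k)"
    by (intro sum.cong refl sum.swap)
  finally show ?thesis by (simp add: algebra_simps)
qed

text \<open>The \<open>m\<^sup>2\<close> translates of the square of side \<open>p\<close> agree modulo \<open>p\<close> point by point.\<close>

lemma gauss_power_sum_dilate:
  "gauss_cong (gauss_power_sum k (p * m)) (of_nat (m^2) * gauss_power_sum k p) p"
proof -
  have "gauss_cong (gauss_power_sum k (p * m))
     (\<Sum>y1=1..p. \<Sum>y2=1..p. \<Sum>z1<m. \<Sum>z2<m. (of_nat y1 + of_nat y2 * \<i>) ^ k) p"
    unfolding gauss_power_sum_split
  proof (intro gauss_cong_sum gauss_cong_power)
    fix y1 y2 z1 z2 :: nat
    show "gauss_cong (of_nat y1 + of_nat y2 * \<i> + of_nat p * (of_nat z1 + of_nat z2 * \<i>))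
        (of_nat y1 + of_nat y2 * \<i>) p"
      by (rule gauss_congI[of "of_nat z1 + of_nat z2 * \<i>"]) (auto intro: gaussian_ints_intros)
  qed (auto intro!: gaussian_ints_intros)
  also have "(\<Sum>y1=1..p. \<Sum>y2=1..p. \<Sum>z1<m. \<Sum>z2<m. (of_nat y1 + of_nat y2 * \<i>) ^ k)
      = of_nat (m^2) * gauss_power_sum k p"
    unfolding gauss_power_sum_def by (simp add: sum_distrib_left power2_eq_square mult.assoc)
  finally show ?thesis .
qed

text \<open>The first-order Taylor expansion. The derivative \<open>k * x ^ (k - 1)\<close> is left anonymous as \<open>c\<close>:
what matters is that \<open>c\<close> does not depend on the increment \<open>w\<close>, so that the linear terms can
be added up over many increments.\<close>

lemma power_first_order:
  assumes "x \<in> gaussian_ints"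
  shows "\<exists>c\<in>gaussian_ints. \<forall>w\<in>gaussian_ints.
    gauss_cong ((x + of_nat m * w) ^ k) (x ^ k + of_nat m * c * w) (m^2)"
proof (induction k)
  case 0
  show ?case by (intro bexI[of _ 0]) (auto intro: gaussian_ints_intros)
next
  case (Suc k)
  then obtain c where c: "c \<in> gaussian_ints" "\<And>w. w \<in> gaussian_ints \<Longrightarrow>
    gauss_cong ((x + of_nat m * w) ^ k) (x ^ k + of_nat m * c * w) (m^2)" by blast
  show ?case
  proof (intro bexI[of _ "x ^ k + c * x"] ballI)
    fix w assume w: "w \<in> gaussian_ints"
    have "gauss_cong ((x + of_nat m * w) * (x + of_nat m * w) ^ k)
        ((x + of_nat m * w) * (x ^ k + of_nat m * c * w)) (m^2)"
      using assms c w by (intro gauss_cong_mult gauss_cong_refl) (auto intro!: gaussian_ints_intros)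
    also have "gauss_cong ((x + of_nat m * w) * (x ^ k + of_nat m * c * w))
        (x ^ Suc k + of_nat m * (x ^ k + c * x) * w) (m^2)"
      using assms c w by (intro gauss_congI[of "c * w^2"])
        (auto intro!: gaussian_ints_intros simp: algebra_simps power2_eq_square)
    finally show "gauss_cong ((x + of_nat m * w) ^ Suc k)
        (x ^ Suc k + of_nat m * (x ^ k + c * x) * w) (m^2)" by simp
  qed (use assms c in \<open>auto intro!: gaussian_ints_intros\<close>)
qed

text \<open>If \<open>p\<close> divides \<open>m\<close>, then \<open>m * p\<close> divides \<open>m\<^sup>2\<close>, so the first-order expansion around each
point of the small square is valid modulo \<open>m * p\<close>. The \<open>p\<^sup>2\<close> constant terms give the factor
\<open>p\<^sup>2\<close>, and the linear terms cancel because the \<open>p\<^sup>2\<close> increments add up to a multiple of \<open>p\<close>.\<close>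

lemma gauss_power_sum_descent:
  assumes "p dvd m"
  shows "gauss_cong (gauss_power_sum k (m * p)) (of_nat (p^2) * gauss_power_sum k m) (m * p)"
proof -
  have inner: "gauss_cong
     (\<Sum>z1<p. \<Sum>z2<p. (x + of_nat m * (of_nat z1 + of_nat z2 * \<i>)) ^ k)
     (of_nat (p^2) * x ^ k) (m * p)" if x: "x \<in> gaussian_ints" for x
  proof -
    obtain c where c: "c \<in> gaussian_ints" "\<And>w. w \<in> gaussian_ints \<Longrightarrow>
      gauss_cong ((x + of_nat m * w) ^ k) (x ^ k + of_nat m * c * w) (m^2)"
      using power_first_order[OF x] by blast
    have "m * p dvd m^2" using assms by (simp add: power2_eq_square)
    then have "gauss_cong (\<Sum>z1<p. \<Sum>z2<p. (x + of_nat m * (of_nat z1 + of_nat z2 * \<i>)) ^ k)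
       (\<Sum>z1<p. \<Sum>z2<p. x ^ k + of_nat m * c * (of_nat z1 + of_nat z2 * \<i>)) (m * p)"
      by (intro gauss_cong_sum gauss_cong_dvd_modulus[OF c(2)]) (auto intro!: gaussian_ints_intros)
    also have "(\<Sum>z1<p. \<Sum>z2<p. x ^ k + of_nat m * c * (of_nat z1 + of_nat z2 * \<i>))
       = of_nat (p^2) * x ^ k
         + of_nat (m * p) * (c * ((\<Sum>z<p. of_nat z) * (1 + \<i>)))"
      by (simp add: sum.distrib power2_eq_square sum_distrib_left sum_distrib_right algebra_simps)
    also have "gauss_cong (of_nat (p^2) * x ^ k
         + of_nat (m * p) * (c * ((\<Sum>z<p. of_nat z) * (1 + \<i>))))
       (of_nat (p^2) * x ^ k) (m * p)"
    proof (rule gauss_congI)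
      have "1 + \<i> \<in> gaussian_ints" using gaussian_ints_of_nat[of 1 1] by simp
      then show "c * ((\<Sum>z<p. of_nat z) * (1 + \<i>)) \<in> gaussian_ints"
        using c by (intro gaussian_ints_mult gaussian_ints_sum nat_in_gaussian_ints)
    qed simp
    finally show ?thesis .
  qed
  have "gauss_cong (gauss_power_sum k (m * p))
     (\<Sum>y1=1..m. \<Sum>y2=1..m. of_nat (p^2) * (of_nat y1 + of_nat y2 * \<i>) ^ k) (m * p)"
    unfolding gauss_power_sum_split
    by (intro gauss_cong_sum inner gaussian_ints_of_nat)
  then show ?thesis unfolding gauss_power_sum_def by (simp add: sum_distrib_left)
qed

text \<open>Each descent step gains a factor \<open>p\<^sup>2\<close> while the modulus loses only one factor \<open>p\<close>. A square
factor of \<open>n\<close> suffices to start: the gained \<open>p\<^sup>2\<close> is then already the whole modulus. Hence only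
primes dividing \<open>n\<close> exactly once can obstruct divisibility of the power sum by \<open>n\<close>.\<close>

lemma gauss_power_sum_cong_0_higher_power:
  assumes "p ^ Suc (Suc s) dvd n"
  shows "gauss_cong (gauss_power_sum k n) 0 (p ^ Suc (Suc s))"
  using assms
proof (induction s arbitrary: n)
  case 0
  then obtain e where "n = p ^ Suc (Suc 0) * e" by (rule dvdE)
  then have n: "n = (p * e) * p" by simp
  have "gauss_cong (gauss_power_sum k n) (of_nat (p^2) * gauss_power_sum k (p * e)) (p^2)"
    using gauss_cong_dvd_modulus[OF gauss_power_sum_descent[of p "p * e" k], of "p^2"]
    by (simp add: n power2_eq_square)
  also have "gauss_cong (of_nat (p^2) * gauss_power_sum k (p * e)) 0 (p^2)"
    by (rule gauss_congI[OF gauss_power_sum_in_gaussian_ints[of k "p * e"]]) simp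
  finally show ?case by (simp add: power2_eq_square)
next
  case (Suc s)
  from Suc.prems obtain e where e: "n = p ^ Suc (Suc (Suc s)) * e" by (rule dvdE)
  define m where "m = p ^ Suc (Suc s) * e"
  have n: "n = m * p" and m: "p ^ Suc (Suc s) dvd m" "p dvd m"
    unfolding m_def e by (simp_all add: ac_simps)
  have "gauss_cong (gauss_power_sum k n) (of_nat (p^2) * gauss_power_sum k m) (p ^ Suc (Suc (Suc s)))"
    unfolding n by (rule gauss_cong_dvd_modulus[OF gauss_power_sum_descent[OF m(2)]])
      (use Suc.prems n in simp)
  moreover have "gauss_cong (of_nat (p^2) * gauss_power_sum k m) 0 (p^2 * p ^ Suc (Suc s))"
    by (intro gauss_cong_0_mult_modulus Suc.IH m)
  then have "gauss_cong (of_nat (p^2) * gauss_power_sum k m) 0 (p ^ Suc (Suc (Suc s)))"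
    by (rule gauss_cong_dvd_modulus) (simp add: power2_eq_square)
  ultimately show ?case by (rule gauss_cong_trans)
qed

section \<open>Integer power sums and Frobenius modulo a prime\<close>

text \<open>Telescoping \<open>(a + 1) ^ (j + 1) - a ^ (j + 1)\<close> over \<open>a\<close> yields the recursion for integer power
sums; it determines them modulo \<open>p\<close> as long as the leading coefficient \<open>j + 1\<close> is below \<open>p\<close>.\<close>

lemma power_sum_telescope:
  "(n + 1) ^ Suc j = 1 + (\<Sum>t\<le>j. (Suc j choose t) * (\<Sum>a=1..n. a ^ t))" for n :: nat
proof (induction n)
  case (Suc n)
  have "(Suc n + 1) ^ Suc j = (\<Sum>t\<le>j. (Suc j choose t) * Suc n ^ t) + Suc n ^ Suc j"
    by (subst binomial) (simp del: power_Suc)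
  also have "Suc n ^ Suc j = 1 + (\<Sum>t\<le>j. (Suc j choose t) * (\<Sum>a=1..n. a ^ t))"
    using Suc.IH by simp
  finally show ?case by (simp add: sum.distrib[symmetric] distrib_left add.commute del: power_Suc)
qed simp

lemma prime_dvd_power_sum:
  assumes "prime p" "j < p - 1"
  shows "p dvd (\<Sum>a=1..p. a ^ j)"
  using assms(2)
proof (induction j rule: less_induct)
  case (less j)
  let ?T = "\<lambda>j. \<Sum>a=1..p. a ^ j"
  have "(p + 1) ^ Suc j = 1 + ((\<Sum>t<j. (Suc j choose t) * ?T t) + Suc j * ?T j)"
    unfolding power_sum_telescope lessThan_Suc_atMost[symmetric] by simp
  moreover have "[(p + 1) ^ Suc j = 1] (mod p)"
  proof -
    have "[p + 1 = 0 + 1] (mod p)" by (intro cong_add) (auto simp: cong_def)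
    then have "[p + 1 = 1] (mod p)" by simp
    from cong_pow[OF this, of "Suc j"] show ?thesis by (simp only: power_one)
  qed
  ultimately have "[1 + ((\<Sum>t<j. (Suc j choose t) * ?T t) + Suc j * ?T j) = 1 + 0] (mod p)"
    by simp
  then have "p dvd (\<Sum>t<j. (Suc j choose t) * ?T t) + Suc j * ?T j"
    unfolding cong_add_lcancel_nat cong_0_iff .
  moreover have "p dvd (\<Sum>t<j. (Suc j choose t) * ?T t)"
  proof (rule dvd_sum)
    fix t assume "t \<in> {..<j}"
    then show "p dvd (Suc j choose t) * ?T t" using less by (intro dvd_mult less.IH) auto
  qed
  ultimately have "p dvd Suc j * ?T j" by (simp only: dvd_add_right_iff)
  moreover have "\<not> p dvd Suc j" using less.prems by (intro nat_dvd_not_less) auto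
  ultimately show ?case using assms(1) by (simp only: prime_dvd_mult_iff simp_thms)
qed

text \<open>By Fermat's little theorem all summands but the last are congruent to \<open>1\<close>.\<close>

lemma prime_not_dvd_power_sum:
  assumes "prime p"
  shows "\<not> p dvd (\<Sum>a=1..p. a ^ (p - 1))"
proof
  have p: "p \<ge> 2" using assms by (rule prime_ge_2_nat)
  assume dvd: "p dvd (\<Sum>a=1..p. a ^ (p - 1))"
  have split: "{1..p} = insert p {1..<p}" using p by auto
  have "(\<Sum>a=1..p. a ^ (p - 1)) = p ^ (p - 1) + (\<Sum>a=1..<p. a ^ (p - 1))"
    unfolding split by (subst sum.insert) auto
  moreover have "p dvd p ^ (p - 1)" using p by (intro dvd_power) auto
  ultimately have "p dvd (\<Sum>a=1..<p. a ^ (p - 1))" using dvd by (simp only: dvd_add_right_iff)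
  moreover have "[(\<Sum>a=1..<p. a ^ (p - 1)) = (\<Sum>a=1..<p. 1)] (mod p)"
    using assms by (intro cong_sum fermat_theorem) (auto simp: nat_dvd_not_less)
  ultimately have "p dvd (\<Sum>a=1..<p. 1)" using cong_dvd_iff by blast
  then have "p dvd p - 1" by simp
  moreover have "\<not> p dvd p - 1" using p by (intro nat_dvd_not_less) auto
  ultimately show False by contradiction
qed

text \<open>A double sum of polynomials thereby reduces to products of one-variable power sums, one product
for each monomial.\<close>

lemma sum_square_separate:
  fixes f :: "'s \<Rightarrow> 't \<Rightarrow> 'b \<Rightarrow> 'a::comm_semiring_1"
  shows "(\<Sum>a\<in>A. \<Sum>b\<in>B. \<Sum>s\<in>S. \<Sum>t\<in>T. c s t * f s t a * g s t b)
    = (\<Sum>s\<in>S. \<Sum>t\<in>T. c s t * sum (f s t) A * sum (g s t) B)"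
proof -
  let ?h = "\<lambda>a b s t. c s t * f s t a * g s t b"
  have "(\<Sum>a\<in>A. \<Sum>b\<in>B. \<Sum>s\<in>S. \<Sum>t\<in>T. ?h a b s t)
      = (\<Sum>a\<in>A. \<Sum>s\<in>S. \<Sum>b\<in>B. \<Sum>t\<in>T. ?h a b s t)"
    by (intro sum.cong refl sum.swap)
  also have "\<dots> = (\<Sum>s\<in>S. \<Sum>a\<in>A. \<Sum>b\<in>B. \<Sum>t\<in>T. ?h a b s t)"
    by (rule sum.swap)
  also have "\<dots> = (\<Sum>s\<in>S. \<Sum>a\<in>A. \<Sum>t\<in>T. \<Sum>b\<in>B. ?h a b s t)"
    by (intro sum.cong refl sum.swap)
  also have "\<dots> = (\<Sum>s\<in>S. \<Sum>t\<in>T. \<Sum>a\<in>A. \<Sum>b\<in>B. ?h a b s t)"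
    by (intro sum.cong refl sum.swap)
  finally show ?thesis by (simp only: sum_distrib_left[symmetric] sum_distrib_right[symmetric])
qed

text \<open>This is the argument of Chevalley and Warning: every monomial \<open>a ^ i * b ^ j\<close> of the summand
has \<open>i + j < 2 * (p - 1)\<close>, so one of the two exponents is below \<open>p - 1\<close>, and the sum
over the corresponding variable vanishes modulo \<open>p\<close>.\<close>

lemma double_power_sum_cong_0:
  assumes "prime p" "u + v < 2 * (p - 1)" "\<alpha> \<in> gaussian_ints" "\<beta> \<in> gaussian_ints"
  shows "gauss_cong (\<Sum>a=1..p. \<Sum>b=1..p.
    (of_nat a + of_nat b * \<alpha>) ^ u * (of_nat a + of_nat b * \<beta>) ^ v) 0 p"
proof -
  define T :: "nat \<Rightarrow> complex" where "T j = of_nat (\<Sum>a=1..p. a ^ j)" for j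
  define c where "c s t = of_nat (u choose s) * \<alpha> ^ (u - s) * (of_nat (v choose t) * \<beta> ^ (v - t))" for s t
  have c: "c s t \<in> gaussian_ints" for s t
    unfolding c_def using assms by (intro gaussian_ints_intros)
  have T: "T j \<in> gaussian_ints" for j unfolding T_def by (rule nat_in_gaussian_ints)
  have "(\<Sum>a=1..p. \<Sum>b=1..p.
      (of_nat a + of_nat b * \<alpha>) ^ u * (of_nat a + of_nat b * \<beta>) ^ v)
    = (\<Sum>a=1..p. \<Sum>b=1..p. \<Sum>s\<le>u. \<Sum>t\<le>v.
        c s t * of_nat a ^ (s + t) * of_nat b ^ ((u - s) + (v - t)))"
    unfolding binomial_ring sum_product
    by (intro sum.cong refl) (simp only: c_def power_mult_distrib power_add mult_ac)
  also have "\<dots> = (\<Sum>s\<le>u. \<Sum>t\<le>v. c s t * T (s + t) * T ((u - s) + (v - t)))"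
    unfolding sum_square_separate by (simp add: T_def)
  finally have eq: "(\<Sum>a=1..p. \<Sum>b=1..p.
      (of_nat a + of_nat b * \<alpha>) ^ u * (of_nat a + of_nat b * \<beta>) ^ v)
    = (\<Sum>s\<le>u. \<Sum>t\<le>v. c s t * T (s + t) * T ((u - s) + (v - t)))" .
  have "gauss_cong (c s t * T (s + t) * T ((u - s) + (v - t))) 0 p" if "s \<le> u" "t \<le> v" for s t
  proof -
    have T0: "gauss_cong (T j) 0 p" if "j < p - 1" for j
      unfolding T_def gauss_cong_of_nat_0_iff using assms(1) that by (rule prime_dvd_power_sum)
    have "s + t < p - 1 \<or> (u - s) + (v - t) < p - 1"
      using assms(2) that by linarith
    then show ?thesis
    proof
      assume "s + t < p - 1"
      then have "gauss_cong ((c s t * T ((u - s) + (v - t))) * T (s + t)) 0 p"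
        by (intro gauss_cong_0_mult T0 gaussian_ints_mult c T)
      then show ?thesis by (simp add: mult_ac)
    next
      assume "(u - s) + (v - t) < p - 1"
      then show ?thesis by (intro gauss_cong_0_mult T0 gaussian_ints_mult c T)
    qed
  qed
  then have "gauss_cong (\<Sum>s\<le>u. \<Sum>t\<le>v. c s t * T (s + t) * T ((u - s) + (v - t)))
      (\<Sum>s\<le>u. \<Sum>t\<le>v. 0) p"
    by (intro gauss_cong_sum) auto
  then show ?thesis unfolding eq by simp
qed

lemma freshman_dream:
  assumes "prime p" "x \<in> gaussian_ints" "y \<in> gaussian_ints"
  shows "gauss_cong ((x + y) ^ p) (x ^ p + y ^ p) p"
proof -
  have p: "p \<ge> 2" using assms(1) by (rule prime_ge_2_nat)
  let ?f = "\<lambda>k. of_nat (p choose k) * x ^ k * y ^ (p - k)"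
  have split: "{..p} = insert 0 (insert p {1..<p})" using p by auto
  have "(x + y) ^ p = x ^ p + y ^ p + (\<Sum>k=1..<p. ?f k)"
    unfolding binomial_ring split using p by (subst sum.insert sum.insert; simp)+
  moreover have "gauss_cong (\<Sum>k=1..<p. ?f k) (\<Sum>k=1..<p. 0) p"
  proof (intro gauss_cong_sum)
    fix k assume "k \<in> {1..<p}"
    then have "p dvd (p choose k)" using assms(1) by (intro dvd_choose_prime) auto
    then have "gauss_cong (x ^ k * y ^ (p - k) * of_nat (p choose k)) 0 p"
      using assms by (intro gauss_cong_0_mult gaussian_ints_intros) (auto simp: gauss_cong_of_nat_0_iff)
    then show "gauss_cong (?f k) 0 p" by (simp add: mult_ac)
  qed
  ultimately show ?thesis
    using gauss_cong_add[OF gauss_cong_refl[of "x ^ p + y ^ p" p]] by fastforce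
qed

lemma gauss_fermat_nat:
  assumes "prime p"
  shows "gauss_cong (of_nat a ^ p) (of_nat a) p"
proof (induction a)
  case 0
  show ?case using assms by (simp add: zero_power prime_gt_0_nat)
next
  case (Suc a)
  have "gauss_cong ((of_nat a + of_nat 1) ^ p) (of_nat a ^ p + of_nat 1 ^ p) p"
    by (intro freshman_dream assms nat_in_gaussian_ints)
  also have "gauss_cong (of_nat a ^ p + of_nat 1 ^ p) (of_nat a + 1) p"
    by (intro gauss_cong_add Suc.IH) simp
  finally show ?case by (simp add: add.commute)
qed

text \<open>Raising to the \<open>p\<close>-th power fixes integers modulo \<open>p\<close>, so it only acts on \<open>\<i>\<close>: trivially if
\<open>p \<equiv> 1 (mod 4)\<close>, and by conjugation if \<open>p \<equiv> 3 (mod 4)\<close>.\<close>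

lemma gauss_frobenius:
  assumes "prime p"
  shows "gauss_cong ((of_nat a + of_nat b * \<i>) ^ p) (of_nat a + of_nat b * \<i> ^ p) p"
proof -
  have "gauss_cong ((of_nat a + of_nat b * \<i>) ^ p) (of_nat a ^ p + (of_nat b * \<i>) ^ p) p"
    by (intro freshman_dream assms gaussian_ints_intros)
  also have "gauss_cong (of_nat a ^ p + (of_nat b * \<i>) ^ p) (of_nat a + of_nat b * \<i> ^ p) p"
    unfolding power_mult_distrib
    by (intro gauss_cong_add gauss_cong_mult gauss_fermat_nat assms gauss_cong_refl gaussian_ints_intros)
  finally show ?thesis .
qed

text \<open>Once \<open>x ^ (q + 1) \<equiv> x\<close>, positive exponents matter only modulo \<open>q\<close>. The remainder \<open>r\<close> has to
stay positive, since \<open>x\<close> need not be invertible modulo \<open>p\<close>.\<close>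

lemma gauss_power_reduce:
  assumes "x \<in> gaussian_ints" "gauss_cong (x ^ Suc q) x p" "r \<ge> 1"
  shows "gauss_cong (x ^ (m * q + r)) (x ^ r) p"
proof (induction m)
  case (Suc m)
  have "x ^ (Suc m * q + r) = x ^ (m * q + (r - 1)) * x ^ Suc q"
  proof -
    have "Suc m * q + r = (m * q + (r - 1)) + Suc q" using assms(3) by simp
    then show ?thesis by (simp only: power_add)
  qed
  moreover have "gauss_cong (x ^ (m * q + (r - 1)) * x ^ Suc q) (x ^ (m * q + (r - 1)) * x) p"
    using assms by (intro gauss_cong_mult gauss_cong_refl gaussian_ints_power)
  moreover have "x ^ (m * q + (r - 1)) * x = x ^ (m * q + r)"
  proof -
    have "m * q + r = Suc (m * q + (r - 1))" using assms(3) by simp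
    then show ?thesis by (simp only: power_Suc2)
  qed
  ultimately show ?case using Suc.IH by (simp del: power_Suc) (metis gauss_cong_trans)
qed simp

lemma imaginary_unit_power_mod_4: "\<i> ^ n = \<i> ^ (n mod 4)"
proof -
  have "\<i> ^ n = \<i> ^ (4 * (n div 4) + n mod 4)" by simp
  then have "\<i> ^ n = (\<i> ^ 4) ^ (n div 4) * \<i> ^ (n mod 4)" by (simp only: power_add power_mult)
  moreover have "\<i> ^ 4 = (\<i> ^ 2) ^ 2" by (simp only: power_mult[symmetric]) simp
  ultimately show ?thesis by simp
qed

section \<open>Gaussian power sums modulo a prime\<close>

text \<open>Squaring sends \<open>a + b \<i>\<close> to \<open>a + b\<close> modulo \<open>2\<close>, which turns the four summands into integer
powers whose sum is even.\<close>

lemma gauss_power_sum_2_cong_0: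
  assumes "even k" "k > 0"
  shows "gauss_cong (gauss_power_sum k 2) 0 2"
proof -
  obtain m where k: "k = 2 * m" and m: "m > 0" using assms by (auto elim!: evenE)
  have "gauss_cong ((of_nat a + of_nat b * \<i>) ^ k) (of_nat ((a + b) ^ m)) 2" for a b :: nat
  proof -
    let ?x = "of_nat a + of_nat b * \<i>"
    have sq: "gauss_cong (?x ^ 2) (of_nat (a + b)) 2"
    proof -
      have "gauss_cong (?x ^ 2) (of_nat a + of_nat b * \<i> ^ 2) 2"
        by (rule gauss_frobenius) simp
      also have "gauss_cong (of_nat a + of_nat b * \<i> ^ 2) (of_nat (a + b)) 2"
        by (rule gauss_congI[of "- of_nat b"]) (auto intro: gaussian_ints_intros)
      finally show ?thesis .
    qed
    have "gauss_cong ((?x ^ 2) ^ m) (of_nat (a + b) ^ m) 2"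
      by (intro gauss_cong_power sq gaussian_ints_intros)
    then show ?thesis unfolding k power_mult of_nat_power .
  qed
  then have "gauss_cong (gauss_power_sum k 2) (\<Sum>a=1..2. \<Sum>b=1..2. of_nat ((a + b) ^ m)) 2"
    unfolding gauss_power_sum_def by (intro gauss_cong_sum)
  also have "(\<Sum>a=1..2. \<Sum>b=1..2. of_nat ((a + b) ^ m)) = (of_nat (2 ^ m + 2 * 3 ^ m + 4 ^ m) :: complex)"
  proof -
    have "{1..2::nat} = {1, 2}" by auto
    then show ?thesis by simp
  qed
  also have "gauss_cong (of_nat (2 ^ m + 2 * 3 ^ m + 4 ^ m)) 0 2"
    unfolding gauss_cong_of_nat_0_iff using m by simp
  finally show ?thesis .
qed

text \<open>Division with remainder, with remainders normalised to \<open>1, ..., q\<close> in place of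
\<open>0, ..., q - 1\<close>, as exponent reduction requires.\<close>

lemma split_exponent:
  assumes "k \<ge> 1" "q \<ge> 1"
  obtains m r :: nat where "k = m * q + r" "1 \<le> r" "r \<le> q"
proof
  show "k = (k - 1) div q * q + ((k - 1) mod q + 1)"
    using assms(1) by (simp only: add.assoc[symmetric] div_mult_mod_eq)
  show "1 \<le> (k - 1) mod q + 1" by simp
  show "(k - 1) mod q + 1 \<le> q" using assms(2) mod_less_divisor[of q "k - 1"] by linarith
qed

text \<open>If \<open>p \<equiv> 1 (mod 4)\<close>, then \<open>x ^ p \<equiv> x\<close>, so the exponent may be taken to be at most \<open>p - 1\<close>,
well below the degree \<open>2 * (p - 1)\<close> at which a double sum can survive.\<close>

lemma gauss_power_sum_split_prime_cong_0:
  assumes "prime p" "[p = 1] (mod 4)" "k \<ge> 1"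
  shows "gauss_cong (gauss_power_sum k p) 0 p"
proof -
  have p: "p \<ge> 2" using assms(1) by (rule prime_ge_2_nat)
  obtain m r where k: "k = m * (p - 1) + r" and r: "1 \<le> r" "r \<le> p - 1"
  proof -
    have "p - 1 \<ge> 1" using p by simp
    from split_exponent[OF assms(3) this] that show ?thesis by blast
  qed
  have "\<i> ^ p = \<i>"
    using assms(2) by (subst imaginary_unit_power_mod_4) (simp add: cong_def)
  then have "gauss_cong ((of_nat a + of_nat b * \<i>) ^ Suc (p - 1)) (of_nat a + of_nat b * \<i>) p" for a b
    using gauss_frobenius[OF assms(1), of a b] p by simp
  then have "gauss_cong (gauss_power_sum k p)
      (\<Sum>a=1..p. \<Sum>b=1..p. (of_nat a + of_nat b * \<i>) ^ r) p"
    unfolding gauss_power_sum_def k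
    by (intro gauss_cong_sum gauss_power_reduce r gaussian_ints_of_nat)
  also have "gauss_cong (\<Sum>a=1..p. \<Sum>b=1..p. (of_nat a + of_nat b * \<i>) ^ r) 0 p"
    using double_power_sum_cong_0[OF assms(1), of 0 r 0 \<i>] r p
    by (simp add: gaussian_ints_0)
  finally show ?thesis .
qed

lemma gauss_frobenius_inert:
  assumes "prime p" "[p = 3] (mod 4)"
  shows "gauss_cong ((of_nat a + of_nat b * \<i>) ^ p) (of_nat a + of_nat b * - \<i>) p"
proof -
  have "\<i> ^ p = \<i> ^ 3"
    using assms(2) by (subst imaginary_unit_power_mod_4) (simp add: cong_def)
  then have "\<i> ^ p = - \<i>" by (simp add: eval_nat_numeral)
  then show ?thesis using gauss_frobenius[OF assms(1), of a b] by simp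
qed

lemma gauss_frobenius_twice_inert:
  assumes "prime p" "[p = 3] (mod 4)"
  shows "gauss_cong ((of_nat a + of_nat b * \<i>) ^ p^2) (of_nat a + of_nat b * \<i>) p"
proof -
  let ?x = "of_nat a + of_nat b * \<i>" and ?y = "of_nat a + of_nat b * - \<i>"
  have odd: "odd p" using assms(2) unfolding cong_def by presburger
  have "\<i> ^ p = \<i> ^ 3"
    using assms(2) by (subst imaginary_unit_power_mod_4) (simp add: cong_def)
  then have "(- \<i>) ^ p = \<i>" using odd by (simp add: power3_eq_cube)
  then have eq: "of_nat a ^ p + (of_nat b * - \<i>) ^ p = of_nat a ^ p + of_nat b ^ p * \<i>"
    by (simp only: power_mult_distrib)
  have "gauss_cong ((?x ^ p) ^ p) (?y ^ p) p"
    by (intro gauss_cong_power gauss_frobenius_inert assms gaussian_ints_intros)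
  also have "gauss_cong (?y ^ p) (of_nat a ^ p + (of_nat b * - \<i>) ^ p) p"
    by (intro freshman_dream assms gaussian_ints_intros)
  finally have "gauss_cong ((?x ^ p) ^ p) (of_nat a ^ p + of_nat b ^ p * \<i>) p"
    unfolding eq .
  also have "gauss_cong (of_nat a ^ p + of_nat b ^ p * \<i>) ?x p"
    by (intro gauss_cong_add gauss_cong_mult gauss_fermat_nat assms gauss_cong_refl gaussian_ints_intros)
  finally show ?thesis unfolding power2_eq_square power_mult .
qed

text \<open>The base-\<open>p\<close> digits of the reduced exponent \<open>r\<close> enter here: the digit of weight \<open>p\<close> counts
conjugate factors, because \<open>x ^ p\<close> is the conjugate of \<open>x\<close> modulo \<open>p\<close>. This lowers the degree
in \<open>a\<close> and \<open>b\<close> from \<open>r\<close> to the sum of its two digits.\<close>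

lemma gauss_power_sum_inert_reduce:
  assumes "prime p" "[p = 3] (mod 4)" "k = m * (p^2 - 1) + r" "1 \<le> r"
  shows "gauss_cong (gauss_power_sum k p) (\<Sum>a=1..p. \<Sum>b=1..p.
    (of_nat a + of_nat b * - \<i>) ^ (r div p) * (of_nat a + of_nat b * \<i>) ^ (r mod p)) p"
  unfolding gauss_power_sum_def
proof (intro gauss_cong_sum)
  fix a b :: nat
  let ?x = "of_nat a + of_nat b * \<i>" and ?y = "of_nat a + of_nat b * - \<i>"
  have p: "Suc (p^2 - 1) = p^2" using prime_gt_0_nat[OF assms(1)] by simp
  have "gauss_cong (?x ^ k) (?x ^ r) p"
    unfolding assms(3) by (intro gauss_power_reduce gaussian_ints_of_nat assms)
      (use gauss_frobenius_twice_inert[OF assms(1,2)] p in simp)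
  moreover have "?x ^ r = (?x ^ p) ^ (r div p) * ?x ^ (r mod p)"
    by (simp flip: power_mult power_add)
  moreover have "gauss_cong ((?x ^ p) ^ (r div p) * ?x ^ (r mod p)) (?y ^ (r div p) * ?x ^ (r mod p)) p"
    by (intro gauss_cong_mult gauss_cong_power gauss_frobenius_inert assms gauss_cong_refl gaussian_ints_intros)
  ultimately show "gauss_cong (?x ^ k) (?y ^ (r div p) * ?x ^ (r mod p)) p"
    using gauss_cong_trans by simp
qed

text \<open>A digit sum \<open>2 * (p - 1)\<close> occurs only for the largest two-digit number \<open>r = p\<^sup>2 - 1\<close>, which
is the reduced exponent exactly for the multiples of \<open>p\<^sup>2 - 1\<close>.\<close>

lemma gauss_power_sum_inert_cong_0:
  assumes "prime p" "[p = 3] (mod 4)" "k \<ge> 1" "\<not> p^2 - 1 dvd k"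
  shows "gauss_cong (gauss_power_sum k p) 0 p"
proof -
  have p: "p \<ge> 2" using assms(1) by (rule prime_ge_2_nat)
  have p2: "p^2 \<ge> 4" using power_mono[OF p, of 2] by simp
  obtain m r where k: "k = m * (p^2 - 1) + r" and r: "1 \<le> r" "r \<le> p^2 - 1"
  proof -
    have "p^2 - 1 \<ge> 1" using p2 by simp
    from split_exponent[OF assms(3) this] that show ?thesis by blast
  qed
  have "r \<noteq> p^2 - 1" using assms(4) k by auto
  with r have less: "r < p^2 - 1" by simp
  have "r div p < p" using less by (intro less_mult_imp_div_less) (simp add: power2_eq_square)
  moreover have "r mod p < p" using p by simp
  moreover have "\<not> (r div p = p - 1 \<and> r mod p = p - 1)"
  proof
    assume "r div p = p - 1 \<and> r mod p = p - 1"
    then have "r = (p - 1) * p + (p - 1)" by (metis div_mult_mod_eq)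
    also have "\<dots> = p^2 - 1" using p by (simp add: power2_eq_square diff_mult_distrib)
    finally show False using less by simp
  qed
  ultimately have "r div p + r mod p < 2 * (p - 1)" by linarith
  then have "gauss_cong (\<Sum>a=1..p. \<Sum>b=1..p.
    (of_nat a + of_nat b * - \<i>) ^ (r div p) * (of_nat a + of_nat b * \<i>) ^ (r mod p)) 0 p"
    by (intro double_power_sum_cong_0 assms gaussian_ints_intros)
  then show ?thesis
    using gauss_power_sum_inert_reduce[OF assms(1,2) k r(1)] by (rule gauss_cong_trans[rotated])
qed

text \<open>Here the summand becomes the norm power \<open>(a\<^sup>2 + b\<^sup>2) ^ (p - 1)\<close>, whose only monomial with a
nonvanishing sum modulo \<open>p\<close> is the middle one, \<open>a ^ (p - 1) * b ^ (p - 1)\<close>. Its coefficient is a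
binomial coefficient with upper index \<open>p - 1\<close> and hence prime to \<open>p\<close>.\<close>

lemma gauss_power_sum_inert_not_cong_0:
  assumes "prime p" "[p = 3] (mod 4)" "k \<ge> 1" "p^2 - 1 dvd k"
  shows "\<not> gauss_cong (gauss_power_sum k p) 0 p"
proof
  assume zero: "gauss_cong (gauss_power_sum k p) 0 p"
  have p: "p \<ge> 2" using assms(1) by (rule prime_ge_2_nat)
  have p2: "p^2 \<ge> 4" using power_mono[OF p, of 2] by simp
  have odd: "odd p" using assms(2) unfolding cong_def by presburger
  define h where "h = (p - 1) div 2"
  have h: "p - 1 = 2 * h" unfolding h_def using odd by simp
  let ?T = "\<lambda>j. \<Sum>a=1..p. a ^ j"
  let ?N = "\<Sum>a=1..p. \<Sum>b=1..p. (a ^ 2 + b ^ 2) ^ (p - 1)"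
  define r where "r = p^2 - 1"
  obtain e where e: "k = (p^2 - 1) * e" using assms(4) by (rule dvdE)
  have "e \<ge> 1" using assms(3) e by (cases e) auto
  then have k: "k = (e - 1) * (p^2 - 1) + r" unfolding e r_def by (cases e) auto
  have "r = (p - 1) * p + (p - 1)" unfolding r_def
    using p by (simp add: power2_eq_square diff_mult_distrib)
  then have "r = (p - 1) + (p - 1) * p" by simp
  then have r: "r div p = p - 1" "r mod p = p - 1" "1 \<le> r"
  proof -
    assume r: "r = (p - 1) + (p - 1) * p"
    have "r div p = (p - 1) + (p - 1) div p"
      unfolding r using p by (intro div_mult_self1) simp
    then show "r div p = p - 1" using p by simp
    show "r mod p = p - 1" unfolding r mod_mult_self1 using p by simp
    show "1 \<le> r" unfolding r using p by simp
  qed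
  have norm: "(of_nat a + of_nat b * - \<i>) ^ (p - 1) * (of_nat a + of_nat b * \<i>) ^ (p - 1)
      = (of_nat ((a ^ 2 + b ^ 2) ^ (p - 1)) :: complex)" for a b
    by (simp add: algebra_simps power2_eq_square flip: power_mult_distrib)
  have "gauss_cong (gauss_power_sum k p) (of_nat ?N) p"
    using gauss_power_sum_inert_reduce[OF assms(1,2) k r(3)]
    unfolding r norm of_nat_sum[symmetric] .
  from gauss_cong_trans[OF gauss_cong_sym[OF this] zero]
  have "p dvd ?N" unfolding gauss_cong_of_nat_0_iff .
  \<comment> \<open>The one-element inner sum gives the expansion the shape of \<open>sum_square_separate\<close>.\<close>
  also have "?N = (\<Sum>a=1..p. \<Sum>b=1..p. \<Sum>s\<le>p - 1. \<Sum>t\<in>{()}.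
      ((p - 1) choose s) * a ^ (2 * s) * b ^ (2 * (p - 1 - s)))"
    by (simp only: binomial power_mult sum.insert finite.emptyI empty_iff sum.empty
        add_0_right of_nat_id simp_thms)
  also have "\<dots> = (\<Sum>s\<le>p - 1. ((p - 1) choose s) * ?T (2 * s) * ?T (2 * (p - 1 - s)))"
    unfolding sum_square_separate by simp
  also have "\<dots> = ((p - 1) choose h) * ?T (p - 1) * ?T (p - 1)
      + (\<Sum>s\<in>{..p - 1} - {h}. ((p - 1) choose s) * ?T (2 * s) * ?T (2 * (p - 1 - s)))"
  proof -
    have "h \<in> {..p - 1}" and mid: "2 * h = p - 1" "2 * (p - 1 - h) = p - 1" using h by auto
    then show ?thesis by (subst sum.remove[of "{..p - 1}" h]) (simp_all only: mid finite_atMost)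
  qed
  finally have "p dvd ((p - 1) choose h) * ?T (p - 1) * ?T (p - 1)
      + (\<Sum>s\<in>{..p - 1} - {h}. ((p - 1) choose s) * ?T (2 * s) * ?T (2 * (p - 1 - s)))" .
  moreover have "p dvd (\<Sum>s\<in>{..p - 1} - {h}. ((p - 1) choose s) * ?T (2 * s) * ?T (2 * (p - 1 - s)))"
  proof (intro dvd_sum)
    fix s assume s: "s \<in> {..p - 1} - {h}"
    then have "2 * s < p - 1 \<or> 2 * (p - 1 - s) < p - 1" using h by auto
    then show "p dvd ((p - 1) choose s) * ?T (2 * s) * ?T (2 * (p - 1 - s))"
      using prime_dvd_power_sum[OF assms(1)] by (blast intro: dvd_mult dvd_mult2)
  qed
  ultimately have "p dvd ((p - 1) choose h) * ?T (p - 1) * ?T (p - 1)"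
    by (simp only: dvd_add_left_iff)
  then have "p dvd ((p - 1) choose h)"
    using assms(1) prime_not_dvd_power_sum[OF assms(1)] by (simp only: prime_dvd_mult_iff simp_thms)
  then have "p dvd fact h * fact (p - 1 - h) * ((p - 1) choose h)" by (rule dvd_mult)
  also have "\<dots> = fact (p - 1)" using h by (intro binomial_fact_lemma) auto
  finally have "p \<le> p - 1" unfolding prime_dvd_fact_iff[OF assms(1)] .
  then show False using p by simp
qed

section \<open>The exceptional exponents\<close>

lemma prime_cube_minus_dvd_iff:
  fixes p n :: nat
  assumes "prime p"
  shows "p ^ 3 - p dvd n \<longleftrightarrow> p dvd n \<and> p^2 - 1 dvd n"
proof -
  have "p \<ge> 2" using assms by (rule prime_ge_2_nat)
  have eq: "p ^ 3 - p = p * (p^2 - 1)" by (simp add: diff_mult_distrib2 eval_nat_numeral)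
  have "coprime p (p^2 - 1)"
  proof -
    have "p^2 \<ge> 1" using \<open>p \<ge> 2\<close> by simp
    then have "\<not> p dvd p^2 - 1"
      using assms dvd_diffD1[of p "p^2" 1] by (auto simp: prime_nat_iff)
    then show ?thesis using assms by (simp add: prime_imp_coprime)
  qed
  then show ?thesis unfolding eq by (auto intro: divides_mult dest: dvd_mult_left dvd_mult_right)
qed

text \<open>A prime power obstructing divisibility has exponent \<open>1\<close> by the descent, and its prime is neither
\<open>2\<close> nor congruent to \<open>1\<close> modulo \<open>4\<close>. Conversely, if \<open>p\<close> divides \<open>n\<close> exactly once, the factor
\<open>(n / p)\<^sup>2\<close> is invertible modulo \<open>p\<close>, so a nonzero sum over one residue system is not lost.\<close>

lemma not_in_M_set_iff:
  assumes "n \<ge> 1"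
  shows "n \<notin> M_set \<longleftrightarrow> (\<exists>p. prime p \<and> [p = 3] (mod 4) \<and> n \<in> U_set p)"
proof
  assume "n \<notin> M_set"
  then have nonzero: "\<not> gauss_cong (gauss_power_sum n n) 0 n" using assms unfolding M_set_def by auto
  obtain p s where p: "prime p" and s: "s \<ge> 1" "p ^ s dvd n"
    and not0: "\<not> gauss_cong (gauss_power_sum n n) 0 (p ^ s)"
  proof -
    have "gauss_cong (gauss_power_sum n n) 0 n"
      if "\<And>p s. prime p \<Longrightarrow> s \<ge> 1 \<Longrightarrow> p ^ s dvd n \<Longrightarrow> gauss_cong (gauss_power_sum n n) 0 (p ^ s)"
      by (rule gauss_cong_0_if_prime_powers[OF gauss_power_sum_in_gaussian_ints assms that])
    with nonzero that show ?thesis by blast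
  qed
  have "s = 1"
  proof (rule ccontr)
    assume "s \<noteq> 1"
    with s(1) have t: "s = Suc (Suc (s - 2))" by simp
    have "gauss_cong (gauss_power_sum n n) 0 (p ^ s)"
      using gauss_power_sum_cong_0_higher_power[of p "s - 2" n n] s(2) by (simp only: t[symmetric])
    with not0 show False by contradiction
  qed
  then have pn: "p dvd n" and not0: "\<not> gauss_cong (gauss_power_sum n n) 0 p"
    using s not0 by auto
  obtain m where m: "n = p * m" using pn by (rule dvdE)
  have dilate: "gauss_cong (gauss_power_sum n n) (of_nat (m^2) * gauss_power_sum n p) p"
    using gauss_power_sum_dilate[of n p m] by (simp only: m[symmetric])
  have prime_sum: "\<not> gauss_cong (gauss_power_sum n p) 0 p"
  proof
    assume "gauss_cong (gauss_power_sum n p) 0 p"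
    then have "gauss_cong (of_nat (m^2) * gauss_power_sum n p) 0 p"
      by (rule gauss_cong_0_mult) (rule nat_in_gaussian_ints)
    with dilate have "gauss_cong (gauss_power_sum n n) 0 p" by (rule gauss_cong_trans)
    with not0 show False by contradiction
  qed
  have "\<not> p^2 dvd n"
  proof
    assume "p^2 dvd n"
    then have "p ^ Suc (Suc 0) dvd n" by (simp add: power2_eq_square)
    from gauss_power_sum_cong_0_higher_power[OF this]
    have "gauss_cong (gauss_power_sum n n) 0 p" by (rule gauss_cong_dvd_modulus) simp
    with not0 show False by contradiction
  qed
  moreover have p3: "[p = 3] (mod 4)"
  proof -
    have "p \<noteq> 2"
    proof
      assume p2: "p = 2"
      have "even n" using pn unfolding p2 .
      moreover have "n > 0" using assms by simp
      ultimately have "gauss_cong (gauss_power_sum n p) 0 p"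
        unfolding p2 by (rule gauss_power_sum_2_cong_0)
      with prime_sum show False by contradiction
    qed
    then have "p > 2" using prime_ge_2_nat[OF p] by simp
    then have "odd p" by (rule prime_odd_nat[OF p])
    moreover have "\<not> [p = 1] (mod 4)"
    proof
      assume "[p = 1] (mod 4)"
      from gauss_power_sum_split_prime_cong_0[OF p this assms] prime_sum
      show False by contradiction
    qed
    ultimately show ?thesis by (simp add: cong_def) presburger
  qed
  moreover have "p^2 - 1 dvd n"
  proof (rule ccontr)
    assume "\<not> p^2 - 1 dvd n"
    from gauss_power_sum_inert_cong_0[OF p p3 assms this] prime_sum show False by contradiction
  qed
  ultimately show "\<exists>p. prime p \<and> [p = 3] (mod 4) \<and> n \<in> U_set p"
    using p pn assms prime_cube_minus_dvd_iff[OF p] unfolding U_set_def by blast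
next
  assume "\<exists>p. prime p \<and> [p = 3] (mod 4) \<and> n \<in> U_set p"
  then obtain p where p: "prime p" "[p = 3] (mod 4)" and U: "n \<in> U_set p" by blast
  from U have "p ^ 3 - p dvd n" and not_sq: "\<not> p^2 dvd n" unfolding U_set_def by simp_all
  then have pn: "p dvd n" "p^2 - 1 dvd n" by (simp_all only: prime_cube_minus_dvd_iff[OF p(1)])
  obtain m where m: "n = p * m" using pn(1) by (rule dvdE)
  have dilate: "gauss_cong (gauss_power_sum n n) (of_nat (m^2) * gauss_power_sum n p) p"
    using gauss_power_sum_dilate[of n p m] by (simp only: m[symmetric])
  have "\<not> p dvd m" using not_sq unfolding m power2_eq_square by (auto intro: mult_dvd_mono)
  then have pm: "\<not> p dvd m^2" using p(1) prime_dvd_power by blast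
  show "n \<notin> M_set"
  proof
    assume "n \<in> M_set"
    then have "gauss_cong (gauss_power_sum n n) 0 p"
      unfolding M_set_def using gauss_cong_dvd_modulus[OF _ pn(1)] by simp
    then have "gauss_cong (of_nat (m^2) * gauss_power_sum n p) 0 p"
      using gauss_cong_sym[OF dilate] by (rule gauss_cong_trans[rotated])
    then have "gauss_cong (gauss_power_sum n p) 0 p"
      by (rule gauss_cong_0_prime_cancel[OF gauss_power_sum_in_gaussian_ints _ p(1) pm])
    then show False using gauss_power_sum_inert_not_cong_0[OF p assms pn(2)] by contradiction
  qed
qed

section \<open>Density of sets approximated by periodic sets\<close>

text \<open>Removing the first period of length \<open>Q\<close> and shifting back leaves the same set.\<close>

lemma card_periodic_initial_segment:
  fixes A :: "nat set"
  assumes "\<And>n. n + Q \<in> A \<longleftrightarrow> n \<in> A"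
  shows "card (A \<inter> {1..q * Q + r}) = q * card (A \<inter> {1..Q}) + card (A \<inter> {1..r})"
proof (induction q)
  case (Suc q)
  have "A \<inter> {1..Suc q * Q + r} = (A \<inter> {1..Q}) \<union> (\<lambda>n. n + Q) ` (A \<inter> {1..q * Q + r})"
  proof (intro equalityI subsetI)
    fix x assume x: "x \<in> A \<inter> {1..Suc q * Q + r}"
    show "x \<in> (A \<inter> {1..Q}) \<union> (\<lambda>n. n + Q) ` (A \<inter> {1..q * Q + r})"
    proof (cases "x \<le> Q")
      case False
      then have "x = (x - Q) + Q" by simp
      moreover from this have "x - Q \<in> A" using x assms[of "x - Q"] by simp
      then have "x - Q \<in> A \<inter> {1..q * Q + r}" using x False by auto
      ultimately show ?thesis by blast
    qed (use x in auto)
  qed (auto simp: assms)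
  then have "card (A \<inter> {1..Suc q * Q + r})
      = card (A \<inter> {1..Q}) + card ((\<lambda>n. n + Q) ` (A \<inter> {1..q * Q + r}))"
    by (simp only:) (intro card_Un_disjoint; auto)
  also have "card ((\<lambda>n. n + Q) ` (A \<inter> {1..q * Q + r})) = card (A \<inter> {1..q * Q + r})"
    by (intro card_image) (auto simp: inj_on_def)
  finally show ?case using Suc.IH by simp
qed simp

lemma periodic_has_asymptotic_density:
  assumes "\<And>n. n + Q \<in> A \<longleftrightarrow> n \<in> A" "Q > 0"
  shows "has_asymptotic_density A"
proof -
  define c where "c = card (A \<inter> {1..Q})"
  have bound: "\<bar>real (card (A \<inter> {1..N})) / real N - real c / real Q\<bar> \<le> real Q / real N"
    if N: "N > 0" for N
  proof -
    define q r where "q = N div Q" and "r = N mod Q"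
    define d where "d = card (A \<inter> {1..r})"
    have NQ: "N = q * Q + r" unfolding q_def r_def by simp
    have rQ: "r < Q" unfolding r_def using assms(2) by simp
    have "d \<le> card {1..r}" unfolding d_def by (intro card_mono) auto
    then have dr: "d \<le> r" by simp
    have "c \<le> card {1..Q}" unfolding c_def by (intro card_mono) auto
    then have cQ: "c \<le> Q" by simp
    have cd: "card (A \<inter> {1..N}) = q * c + d"
      unfolding NQ c_def d_def by (rule card_periodic_initial_segment[OF assms(1)])
    have "real (card (A \<inter> {1..N})) * Q - real c * N = real d * Q - real c * r"
      unfolding cd by (subst NQ) (simp add: algebra_simps)
    moreover have "real d * Q \<le> real Q * Q" using dr rQ by (intro mult_right_mono) auto
    moreover have "real c * r \<le> real Q * Q" using cQ rQ by (intro mult_mono) auto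
    moreover have "real d * Q \<ge> 0" "real c * r \<ge> 0" by auto
    ultimately have "\<bar>real (card (A \<inter> {1..N})) * Q - real c * N\<bar> \<le> real Q * Q" by linarith
    then have "\<bar>real (card (A \<inter> {1..N})) * Q - real c * N\<bar> / (real N * Q) \<le> real Q * Q / (real N * Q)"
      by (intro divide_right_mono) auto
    moreover have "real (card (A \<inter> {1..N})) / real N - real c / real Q
        = (real (card (A \<inter> {1..N})) * Q - real c * N) / (real N * Q)"
      using N assms(2) by (simp add: field_simps)
    moreover have "\<bar>real N * Q\<bar> = real N * Q" by simp
    ultimately show ?thesis using assms(2) by (simp only: abs_divide) simp
  qed
  have "(\<lambda>N. real Q / real N) \<longlonglongrightarrow> 0" by (rule lim_const_over_n)
  then have "(\<lambda>N. real (card (A \<inter> {1..N})) / real N - real c / real Q) \<longlonglongrightarrow> 0"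
    by (rule tendsto_0_le[where K = 1])
      (use bound in \<open>auto intro!: eventually_sequentiallyI[of 1]\<close>)
  then have "(\<lambda>N. real (card (A \<inter> {1..N})) / real N) \<longlonglongrightarrow> real c / real Q"
    by (simp only: LIM_zero_iff)
  then show ?thesis unfolding has_asymptotic_density_def by (rule convergentI)
qed

text \<open>The density quotients of \<open>A\<close> stay uniformly within \<open>e\<close> of a convergent sequence for every
\<open>e > 0\<close>, hence form a Cauchy sequence.\<close>

lemma has_asymptotic_density_if_approximable:
  assumes "\<And>e. e > 0 \<Longrightarrow> \<exists>B. has_asymptotic_density B \<and>
    (\<forall>N\<ge>1. \<bar>real (card (A \<inter> {1..N})) - real (card (B \<inter> {1..N}))\<bar> \<le> e * real N)"
  shows "has_asymptotic_density A"
  unfolding has_asymptotic_density_def Cauchy_convergent_iff[symmetric]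
proof (rule metric_CauchyI)
  fix e :: real assume e: "e > 0"
  define a where "a N = real (card (A \<inter> {1..N})) / real N" for N
  obtain B where B: "has_asymptotic_density B"
    "\<And>N. N \<ge> 1 \<Longrightarrow> \<bar>real (card (A \<inter> {1..N})) - real (card (B \<inter> {1..N}))\<bar> \<le> e / 4 * real N"
    using assms[of "e / 4"] e by auto
  define b where "b N = real (card (B \<inter> {1..N})) / real N" for N
  have close: "\<bar>a N - b N\<bar> \<le> e / 4" if "N \<ge> 1" for N
  proof -
    have "\<bar>a N - b N\<bar> = \<bar>real (card (A \<inter> {1..N})) - real (card (B \<inter> {1..N}))\<bar> / real N"
      unfolding a_def b_def by (simp add: diff_divide_distrib[symmetric])
    also have "\<dots> \<le> e / 4 * real N / real N"
      by (intro divide_right_mono B that) auto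
    finally show ?thesis using that by simp
  qed
  have "Cauchy b" using B(1) unfolding has_asymptotic_density_def b_def Cauchy_convergent_iff .
  then obtain M where M: "\<And>m n. m \<ge> M \<Longrightarrow> n \<ge> M \<Longrightarrow> dist (b m) (b n) < e / 4"
    using metric_CauchyD[of b "e / 4"] e by auto
  have "dist (a m) (a n) < e" if "m \<ge> max M 1" "n \<ge> max M 1" for m n
    using M[of m n] close[of m] close[of n] that e unfolding dist_real_def by linarith
  then show "\<exists>M. \<forall>m\<ge>M. \<forall>n\<ge>M. dist (real (card (A \<inter> {1..m})) / real m) (real (card (A \<inter> {1..n})) / real n) < e"
    unfolding a_def by blast
qed

text \<open>By comparison with the telescoping differences \<open>1 / (p - 1) - 1 / p\<close>.\<close>

lemma sum_inverse_square_tail: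
  assumes "P \<ge> 2"
  shows "(\<Sum>p=P..N. 1 / real (p^2)) \<le> 1 / real (P - 1)"
proof (cases "P \<le> N")
  case True
  have "(\<Sum>p=P..N. 1 / real (p^2)) \<le> 1 / real (P - 1) - 1 / real N"
    using True
  proof (induction N rule: dec_induct)
    case base
    then show ?case using assms by (simp add: field_simps power2_eq_square of_nat_diff)
  next
    case (step N)
    have "real N > 0" using step assms by simp
    then have "1 / real N - 1 / real (Suc N) = 1 / (real N * real (Suc N))"
      by (simp add: field_simps)
    moreover have "1 / real (Suc N ^ 2) \<le> 1 / (real N * real (Suc N))"
    proof (rule frac_le)
      show "real N * real (Suc N) \<le> real (Suc N ^ 2)"
        unfolding of_nat_power power2_eq_square of_nat_mult by (rule mult_right_mono) simp_all
    qed (use \<open>real N > 0\<close> in simp_all)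
    ultimately have "1 / real (Suc N ^ 2) \<le> 1 / real N - 1 / real (Suc N)" by simp
    then show ?case using step by simp
  qed
  also have "\<dots> \<le> 1 / real (P - 1)" by simp
  finally show ?thesis .
qed simp

lemma card_multiples_le: "real (card {n \<in> {1..N}. d dvd n}) \<le> real N / real d" if "d > 0" for d N :: nat
proof -
  have "{n \<in> {1..N}. d dvd n} \<subseteq> (\<lambda>k. d * k) ` {1..N div d}"
  proof
    fix n assume n: "n \<in> {n \<in> {1..N}. d dvd n}"
    then obtain k where k: "n = d * k" by auto
    with n that have "1 \<le> k" "k \<le> N div d" by (auto simp: less_eq_div_iff_mult_less_eq mult.commute Suc_le_eq)
    then show "n \<in> (\<lambda>k. d * k) ` {1..N div d}" using k by auto
  qed
  then have "card {n \<in> {1..N}. d dvd n} \<le> card {1..N div d}"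
    by (rule surj_card_le[rotated]) simp
  then have "real (card {n \<in> {1..N}. d dvd n}) \<le> real (N div d)" by simp
  also have "\<dots> \<le> real N / real d" by (rule of_nat_div_le_of_nat)
  finally show ?thesis .
qed

text \<open>Only finitely many of the conditions \<open>n \<in> U_set p\<close>, those with \<open>p < P\<close>, are kept; they define
a periodic set. A number \<open>n \<le> N\<close> misclassified in this way is a multiple of some
\<open>p ^ 3 - p \<ge> p\<^sup>2\<close> with \<open>p \<ge> P\<close>, so there are at most
\<open>N * (\<Sum>p\<ge>P. 1 / p\<^sup>2) \<le> N / (P - 1)\<close> of them.\<close>

lemma complement_of_union_U_set_has_asymptotic_density:
  assumes "\<And>p. p \<in> S \<Longrightarrow> p \<ge> 2"
  shows "has_asymptotic_density ({1..} - (\<Union>p\<in>S. U_set p))"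
proof (rule has_asymptotic_density_if_approximable)
  fix e :: real assume e: "e > 0"
  obtain P0 where P0: "1 / real (Suc P0) < e" using e nat_approx_posE by blast
  \<comment> \<open>The tail bound \<open>1 / (P - 1)\<close> has to be at most \<open>e\<close>.\<close>
  define P where "P = Suc (Suc P0)"
  define D where "D p = p ^ 3 - p" for p :: nat
  have D: "p^2 \<le> D p" if "p \<ge> 2" for p
  proof -
    have "2 * p \<le> p * p" using that by (rule mult_le_mono1)
    then have "p * (p + 1) \<le> p * (p * p)" using that by (intro mult_le_mono2) linarith
    then show ?thesis unfolding D_def by (simp add: power2_eq_square power3_eq_cube algebra_simps)
  qed
  define B where "B = {n. \<forall>p\<in>S \<inter> {2..<P}. D p dvd n \<longrightarrow> p^2 dvd n}"
  let ?M = "{1..} - (\<Union>p\<in>S. U_set p)"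
  define Q where "Q = (\<Prod>p=2..<P. p^2 * D p)"
  have "Q > 0" unfolding Q_def
  proof (intro prod_pos)
    fix p assume "p \<in> {2..<P}"
    then show "0 < p^2 * D p" using D[of p] by (auto intro: less_le_trans[of 0 "p^2"])
  qed
  moreover have "n + Q \<in> B \<longleftrightarrow> n \<in> B" for n
  proof -
    have "p^2 dvd Q" "D p dvd Q" if "p \<in> {2..<P}" for p
    proof -
      have "p^2 * D p dvd Q" unfolding Q_def by (intro dvd_prodI that) simp
      then show "p^2 dvd Q" "D p dvd Q" by (auto dest: dvd_mult_left dvd_mult_right)
    qed
    then show ?thesis unfolding B_def by (auto simp: dvd_add_left_iff)
  qed
  ultimately have "has_asymptotic_density B" by (intro periodic_has_asymptotic_density)
  moreover have "\<bar>real (card (?M \<inter> {1..N})) - real (card (B \<inter> {1..N}))\<bar> \<le> e * real N" if "N \<ge> 1" for N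
  proof -
    let ?E = "\<lambda>p. {n \<in> {1..N}. D p dvd n}"
    have sub: "?M \<inter> {1..N} \<subseteq> B \<inter> {1..N}"
      unfolding B_def U_set_def D_def by auto
    have "B \<inter> {1..N} - ?M \<inter> {1..N} \<subseteq> (\<Union>p\<in>{P..N}. ?E p)"
    proof
      fix n assume n: "n \<in> B \<inter> {1..N} - ?M \<inter> {1..N}"
      then obtain p where p: "p \<in> S" "n \<in> U_set p" by auto
      then have dvd: "D p dvd n" "\<not> p^2 dvd n" unfolding U_set_def D_def by auto
      have p2: "p \<ge> 2" using assms p by blast
      have "\<not> p < P" using n p(1) dvd p2 unfolding B_def by auto
      moreover have "p \<le> N"
      proof -
        have "p \<le> p^2" by (simp add: power2_eq_square)
        also have "\<dots> \<le> D p" by (rule D[OF p2])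
        also have "\<dots> \<le> n" using dvd n by (intro dvd_imp_le) auto
        finally show ?thesis using n by auto
      qed
      ultimately show "n \<in> (\<Union>p\<in>{P..N}. ?E p)" using dvd n by auto
    qed
    then have "card (B \<inter> {1..N} - ?M \<inter> {1..N}) \<le> card (\<Union>p\<in>{P..N}. ?E p)"
      by (intro card_mono) auto
    also have "\<dots> \<le> (\<Sum>p=P..N. card (?E p))" by (intro card_UN_le) auto
    finally have "real (card (B \<inter> {1..N} - ?M \<inter> {1..N})) \<le> real (\<Sum>p=P..N. card (?E p))"
      by (simp only: of_nat_le_iff)
    also have "\<dots> \<le> (\<Sum>p=P..N. real N * (1 / real (p^2)))"
      unfolding of_nat_sum
    proof (intro sum_mono)
      fix p assume "p \<in> {P..N}"
      then have p: "p \<ge> 2" unfolding P_def by simp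
      then have pos: "0 < p^2" by simp
      have "real (card (?E p)) \<le> real N / real (D p)"
        using pos D[OF p] by (intro card_multiples_le) linarith
      also have "\<dots> \<le> real N / real (p^2)"
        using pos D[OF p] by (intro divide_left_mono) (auto simp only: of_nat_le_iff of_nat_0_le_iff of_nat_0_less_iff intro!: mult_pos_pos)
      finally show "real (card (?E p)) \<le> real N * (1 / real (p^2))" by simp
    qed
    also have "\<dots> = real N * (\<Sum>p=P..N. 1 / real (p^2))" by (simp only: sum_distrib_left)
    also have "\<dots> \<le> real N * (1 / real (P - 1))"
      by (intro mult_left_mono sum_inverse_square_tail) (auto simp: P_def)
    also have "\<dots> \<le> real N * e" using P0 unfolding P_def by (intro mult_left_mono) auto
    finally have "real (card (B \<inter> {1..N} - ?M \<inter> {1..N})) \<le> real N * e" .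
    moreover have "card (B \<inter> {1..N} - ?M \<inter> {1..N}) = card (B \<inter> {1..N}) - card (?M \<inter> {1..N})"
      using sub by (intro card_Diff_subset) (auto intro: finite_subset)
    moreover have "card (?M \<inter> {1..N}) \<le> card (B \<inter> {1..N})" using sub by (intro card_mono) auto
    ultimately show ?thesis by (simp add: of_nat_diff mult.commute)
  qed
  ultimately show "\<exists>B. has_asymptotic_density B \<and>
    (\<forall>N\<ge>1. \<bar>real (card (?M \<inter> {1..N})) - real (card (B \<inter> {1..N}))\<bar> \<le> e * real N)" by blast
qed

theorem proposition10:
  shows "{n::nat. n \<ge> 1} - M_set = (\<Union>p\<in>{p::nat. prime p \<and> [p = 3] (mod 4)}. U_set p)
    \<and> has_asymptotic_density M_set"
proof
  let ?S = "{p::nat. prime p \<and> [p = 3] (mod 4)}"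
  have U: "n \<ge> 1" if "n \<in> U_set p" for n p using that unfolding U_set_def by simp
  show eq: "{n::nat. n \<ge> 1} - M_set = (\<Union>p\<in>?S. U_set p)"
  proof (rule Set.set_eqI)
    fix n
    show "n \<in> {n::nat. n \<ge> 1} - M_set \<longleftrightarrow> n \<in> (\<Union>p\<in>?S. U_set p)"
      using not_in_M_set_iff[of n] U by (cases "n \<ge> 1") auto
  qed
  have "M_set \<subseteq> {n. n \<ge> 1}" unfolding M_set_def by blast
  then have "M_set = {1..} - (\<Union>p\<in>?S. U_set p)" unfolding eq[symmetric] by auto
  moreover have "has_asymptotic_density ({1..} - (\<Union>p\<in>?S. U_set p))"
    by (rule complement_of_union_U_set_has_asymptotic_density) (simp add: prime_ge_2_nat)
  ultimately show "has_asymptotic_density M_set" by simp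
qed

end
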